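(* Let $q$ be a prime power and let $U=(X,B)$ be an abstract unital of order $q$ (i.e. a $2$-$(q^3+1,q+1,1)$ design) which is embedded in the Desarguesian projective plane $\mathsf{PG}(2,q^2)$. Then $U$ is strongly full point regular: for any two disjoint blocks $b_1,b_2\in B$, (a) there is a block $c\in B$ with $c\cap b_1=c\cap b_2=\emptyset$ and $F_U(b_1,b_2)\subseteq c$, and (b) $\mathrm{Persp}_{b_2}(b_1)$ is a cyclic semi-regular permutation group on $b_1$.
   Context: An abstract unital $U=(X,B)$ is embedded in a projective plane $\Pi$ if $X$ is a set of points of $\Pi$ and every block $b\in B$ is of the form $X\cap\ell$ for some line $\ell$ of $\Pi$. For blocks $b_1,b_2$, a point $P\in X$ is a full point with respect to $(b_1,b_2)$ if $P\notin b_1\cup b_2$ and for every $Q\in b_1$ the block through $P$ and $Q$ meets $b_2$; then the map $\pi_{b_1,P,b_2}:b_1\to b_2$ sending $Q$ to the intersection point of the block $PQ$ with $b_2$ is a bijection (the perspectivity with center $P$). $F_U(b_1,b_2)$ denotes the set of full points w.r.t. $(b_1,b_2)$. The group of perspectivities is $\mathrm{Persp}_{b_2}(b_1)=\langle \pi_{b_1,P,b_2}\pi_{b_2,Q,b_1} \mid P,Q\in F_U(b_1,b_2)\rangle$, a permutation group on $b_1$ (generated by the empty set, hence trivial, if $F_U(b_1,b_2)=\emptyset$). A permutation group is semi-regular if all point stabilizers are trivial. *)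

theory Defs
  imports
    "HOL-Analysis.Cartesian_Space"
    "HOL-Number_Theory.Prime_Powers"
    "HOL-Algebra.Bij"
    "HOL-Algebra.Generated_Groups"
    "HOL-Algebra.Elementary_Groups"
    "HOL-Algebra.Group_Action"
begin

definition design2 :: "nat \<Rightarrow> nat \<Rightarrow> nat \<Rightarrow> 'p set \<Rightarrow> 'p set set \<Rightarrow> bool" where
  "design2 v k l X B \<longleftrightarrow>
     finite X \<and> card X = v \<and>
     (\<forall>b\<in>B. b \<subseteq> X \<and> card b = k) \<and>
     (\<forall>P\<in>X. \<forall>Q\<in>X. P \<noteq> Q \<longrightarrow> card {b \<in> B. P \<in> b \<and> Q \<in> b} = l)"

definition abstract_unital :: "nat \<Rightarrow> 'p set \<Rightarrow> 'p set set \<Rightarrow> bool" where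
  "abstract_unital q X B \<longleftrightarrow> design2 (q ^ 3 + 1) (q + 1) 1 X B"

text \<open>The plane \<open>PG(2,F)\<close>: points are the one-dimensional subspaces of \<open>F\<^sup>3\<close>; a line is the set of
  points contained in a two-dimensional subspace.\<close>

definition PG2_points :: "('a::field ^ 3) set set" where
  "PG2_points = {P. vec.subspace P \<and> vec.dim P = 1}"

definition PG2_lines :: "('a::field ^ 3) set set set" where
  "PG2_lines = {{P \<in> PG2_points. P \<subseteq> L} | L. vec.subspace L \<and> vec.dim L = 2}"

definition embedded_in :: "'p set \<Rightarrow> 'p set set \<Rightarrow> 'p set \<Rightarrow> 'p set set \<Rightarrow> bool" where
  "embedded_in X B points lines \<longleftrightarrow>
     X \<subseteq> points \<and> (\<forall>b\<in>B. \<exists>l\<in>lines. b = X \<inter> l)"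

definition block_through :: "'p set set \<Rightarrow> 'p \<Rightarrow> 'p \<Rightarrow> 'p set" where
  "block_through B P Q = (THE b. b \<in> B \<and> P \<in> b \<and> Q \<in> b)"

definition full_points :: "'p set \<Rightarrow> 'p set set \<Rightarrow> 'p set \<Rightarrow> 'p set \<Rightarrow> 'p set" where
  "full_points X B b1 b2 =
     {P \<in> X. P \<notin> b1 \<union> b2 \<and> (\<forall>Q\<in>b1. block_through B P Q \<inter> b2 \<noteq> {})}"

definition perspectivity :: "'p set set \<Rightarrow> 'p set \<Rightarrow> 'p \<Rightarrow> 'p set \<Rightarrow> 'p \<Rightarrow> 'p" where
  "perspectivity B b1 P b2 = (\<lambda>Q\<in>b1. THE R. R \<in> block_through B P Q \<inter> b2)"

text \<open>Products of perspectivities act from the right: the perspectivity from \<open>b1\<close> to \<open>b2\<close> with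
  center \<open>P\<close> is applied first.\<close>

definition persp_generators ::
    "'p set \<Rightarrow> 'p set set \<Rightarrow> 'p set \<Rightarrow> 'p set \<Rightarrow> ('p \<Rightarrow> 'p) set" where
  "persp_generators X B b2 b1 =
     {compose b1 (perspectivity B b2 Q b1) (perspectivity B b1 P b2) | P Q.
        P \<in> full_points X B b1 b2 \<and> Q \<in> full_points X B b1 b2}"

definition Persp :: "'p set \<Rightarrow> 'p set set \<Rightarrow> 'p set \<Rightarrow> 'p set \<Rightarrow> ('p \<Rightarrow> 'p) monoid" where
  "Persp X B b2 b1 =
     (BijGroup b1)\<lparr>carrier := generate (BijGroup b1) (persp_generators X B b2 b1)\<rparr>"

definition permutation_group_on :: "'p set \<Rightarrow> ('p \<Rightarrow> 'p) monoid \<Rightarrow> bool" where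
  "permutation_group_on S G \<longleftrightarrow>
     subgroup (carrier G) (BijGroup S) \<and> G = (BijGroup S)\<lparr>carrier := carrier G\<rparr>"

definition semi_regular_on :: "'p set \<Rightarrow> ('p \<Rightarrow> 'p) monoid \<Rightarrow> bool" where
  "semi_regular_on S G \<longleftrightarrow> (\<forall>x\<in>S. stabilizer G (\<lambda>g. g) x = {\<one>\<^bsub>G\<^esub>})"

definition strongly_full_point_regular :: "'p set \<Rightarrow> 'p set set \<Rightarrow> bool" where
  "strongly_full_point_regular X B \<longleftrightarrow>
     (\<forall>b1\<in>B. \<forall>b2\<in>B. b1 \<inter> b2 = {} \<longrightarrow>
        (\<exists>c\<in>B. c \<inter> b1 = {} \<and> c \<inter> b2 = {} \<and> full_points X B b1 b2 \<subseteq> c) \<and>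
        permutation_group_on b1 (Persp X B b2 b1) \<and>
        cyclic_group (Persp X B b2 b1) \<and>
        semi_regular_on b1 (Persp X B b2 b1))"

end

theory Submission
  imports Defs "HOL-Number_Theory.Residues"
begin

text \<open>
  Let \<open>Z\<close> be the intersection of the lines carrying \<open>b1\<close> and \<open>b2\<close>. A product of two perspectivities
  between \<open>b1\<close> and \<open>b2\<close> extends to a projectivity of the line of \<open>b1\<close> fixing \<open>Z\<close>; taking \<open>Z\<close> as the
  point at infinity, it is an affine map \<open>x \<mapsto> \<alpha> x + \<beta>\<close> of \<open>GF(q\<^sup>2)\<close> that preserves a set \<open>S\<close> of
  \<open>q + 1\<close> elements. Summing over \<open>S\<close> shows that such a translation is trivial, because
  \<open>q + 1 = 1\<close> in the field. If \<open>x\<^sub>0 \<in> S\<close> is fixed, the product of \<open>x - x\<^sub>0\<close> over the other elements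
  of \<open>S\<close> gives \<open>\<alpha>\<^sup>q = 1\<close>, hence \<open>\<alpha> = 1\<close> since \<open>\<alpha>\<close> raised to \<open>q\<^sup>2\<close> is \<open>\<alpha>\<close>. So the group is semi-regular
  and embeds, via \<open>\<alpha>\<close>, into the cyclic multiplicative group of the field. Its elements commute and
  therefore share their fixed point; the line joining two full points passes through this fixed
  point, which puts all full points on one line. With at most one full point, the block required in
  (a) is found by counting blocks.
\<close>

section \<open>Affine maps over a finite field\<close>

text \<open>Multiplication by a nonzero \<open>x\<close> permutes the nonzero elements, so comparing
  their product before and after gives \<open>x ^ (CARD('a) - 1) = 1\<close>. One further factor
  \<open>x\<close> covers \<open>x = 0\<close> as well.\<close>

lemma finite_field_power_card:
  fixes x :: "'a::field"
  assumes fin: "finite (UNIV :: 'a set)"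
  shows "x ^ CARD('a) = x"
proof (cases "x = 0")
  case True
  then show ?thesis using fin by (simp add: card_gt_0_iff)
next
  case False
  have bij: "bij_betw ((*) x) (UNIV - {0}) (UNIV - {0})"
  proof (rule bij_betw_byWitness[where f' = "\<lambda>y. y / x"])
  qed (use False in auto)
  have "(\<Prod>y\<in>UNIV - {0}. y) = (\<Prod>y\<in>UNIV - {0}. x * y)"
    using prod.reindex_bij_betw[OF bij, of "\<lambda>y. y"] by simp
  also have "\<dots> = x ^ (CARD('a) - 1) * (\<Prod>y\<in>UNIV - {0}. y)"
    using fin by (simp add: prod.distrib)
  finally have "x ^ (CARD('a) - 1) = 1"
    using fin by simp
  then have "x * x ^ (CARD('a) - 1) = x" by simp
  moreover have "CARD('a) = Suc (CARD('a) - 1)"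
    using fin by (simp add: card_gt_0_iff)
  ultimately show ?thesis by (metis power_Suc)
qed

text \<open>\<open>S\<close> stands for the coordinates of the points of a block on its line, the
  intersection of the two lines being the point at infinity.\<close>

locale affine_set =
  fixes q :: nat and S :: "'a::field set"
  assumes card_field: "CARD('a) = q ^ 2" and q_pos: "q \<ge> 1" and card_S: "card S = q + 1"
begin

lemma finite_S: "finite S"
  using card_S by (metis Suc_eq_plus1 card.infinite nat.distinct(1))

lemma finite_field: "finite (UNIV :: 'a set)"
  using card_field q_pos by (metis card.infinite not_one_le_zero power_eq_0_iff)

text \<open>The characteristic divides the field order \<open>q ^ 2\<close>, and a field has no zero
  divisors.\<close>

lemma of_nat_q: "of_nat q = (0::'a)"
proof -
  have "of_nat (CARD('a)) = (0::'a)"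
    using CHAR_dvd_CARD[where 'a='a] by (simp add: of_nat_eq_0_iff_char_dvd)
  then show ?thesis by (simp add: card_field)
qed

lemma bij_affine:
  assumes "\<alpha> \<noteq> 0" "\<And>x. x \<in> S \<Longrightarrow> \<alpha> * x + \<beta> \<in> S"
  shows "bij_betw (\<lambda>x. \<alpha> * x + \<beta>) S S"
proof -
  have "inj_on (\<lambda>x. \<alpha> * x + \<beta>) S" using assms(1) by (auto simp: inj_on_def)
  moreover have "(\<lambda>x. \<alpha> * x + \<beta>) ` S \<subseteq> S" using assms(2) by auto
  ultimately show ?thesis
    using finite_S by (simp add: bij_betw_def endo_inj_surj)
qed

lemma translation_trivial:
  assumes "\<And>x. x \<in> S \<Longrightarrow> x + \<beta> \<in> S"
  shows "\<beta> = 0"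
proof -
  have bij: "bij_betw (\<lambda>x. x + \<beta>) S S" using bij_affine[of 1 \<beta>] assms by simp
  have "(\<Sum>x\<in>S. x) = (\<Sum>x\<in>S. x + \<beta>)"
    using sum.reindex_bij_betw[OF bij, of "\<lambda>x. x"] by simp
  also have "\<dots> = (\<Sum>x\<in>S. x) + of_nat (q + 1) * \<beta>"
    by (simp add: sum.distrib card_S)
  finally show ?thesis by (simp add: of_nat_q)
qed

lemma fixed_point_trivial:
  assumes "\<alpha> \<noteq> 0" "\<And>x. x \<in> S \<Longrightarrow> \<alpha> * x + \<beta> \<in> S" and z: "z \<in> S" "\<alpha> * z + \<beta> = z"
  shows "\<alpha> = 1"
proof -
  let ?f = "\<lambda>x. \<alpha> * x + \<beta>"
  have "bij_betw ?f (S - {z}) (S - {?f z})"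
    using bij_betw_DiffI[OF bij_affine[OF assms(1,2)], of "{z}" "{?f z}"] z by auto
  then have bij: "bij_betw ?f (S - {z}) (S - {z})" using z by simp
  have "(\<Prod>x\<in>S - {z}. x - z) = (\<Prod>x\<in>S - {z}. ?f x - z)"
    using prod.reindex_bij_betw[OF bij, of "\<lambda>x. x - z"] by simp
  also have "\<dots> = (\<Prod>x\<in>S - {z}. \<alpha> * (x - z))"
    using z(2) by (intro prod.cong) (auto simp: algebra_simps)
  \<comment> \<open>Removing \<open>z\<close> leaves \<open>q\<close> factors, all of them nonzero,
    so the product can be cancelled.\<close>
  also have "\<dots> = \<alpha> ^ q * (\<Prod>x\<in>S - {z}. x - z)"
    using z card_S by (simp add: prod.distrib)
  finally have "\<alpha> ^ q = 1"
    using finite_S by simp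
  then have "\<alpha> ^ CARD('a) = 1"
    by (simp add: card_field power2_eq_square power_mult)
  then show ?thesis using finite_field_power_card[OF finite_field] by metis
qed

text \<open>The commutator of two affine maps is a translation, so affine maps preserving \<open>S\<close> commute.\<close>

lemma fixed_points_eq:
  assumes "\<alpha> \<noteq> 0" "\<And>x. x \<in> S \<Longrightarrow> \<alpha> * x + \<beta> \<in> S" "\<alpha> \<noteq> 1" "\<alpha> * y + \<beta> = y"
    and "\<alpha>' \<noteq> 0" "\<And>x. x \<in> S \<Longrightarrow> \<alpha>' * x + \<beta>' \<in> S" "\<alpha>' \<noteq> 1" "\<alpha>' * z + \<beta>' = z"
  shows "y = z"
proof -
  \<comment> \<open>With f and g the two maps, f(g(x)) = g(f(x)) + \<open>\<delta>\<close> for every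
    x. Pulling a point of \<open>S\<close> back through g and then f shows that translation by
    \<open>\<delta>\<close> preserves \<open>S\<close>.\<close>
  define \<delta> where "\<delta> = \<alpha> * \<beta>' + \<beta> - \<alpha>' * \<beta> - \<beta>'"
  have "x + \<delta> \<in> S" if x: "x \<in> S" for x
  proof -
    obtain x1 where x1: "x1 \<in> S" "x = \<alpha>' * x1 + \<beta>'"
      using bij_affine[OF assms(5,6)] x by (auto simp: bij_betw_def)
    obtain x2 where x2: "x2 \<in> S" "x1 = \<alpha> * x2 + \<beta>"
      using bij_affine[OF assms(1,2)] x1 by (auto simp: bij_betw_def)
    have "x + \<delta> = \<alpha> * (\<alpha>' * x2 + \<beta>') + \<beta>"
      unfolding x1 x2 \<delta>_def by (simp add: algebra_simps)
    then show ?thesis using assms(2,6) x2 by simp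
  qed
  then have "\<delta> = 0" by (rule translation_trivial)
  \<comment> \<open>Expressed through the fixed points, \<open>\<delta>\<close> becomes a product
    whose only factor that can vanish is \<open>y - z\<close>.\<close>
  moreover have \<beta>: "\<beta> = (1 - \<alpha>) * y" "\<beta>' = (1 - \<alpha>') * z"
    using assms(4,8) by (simp_all add: left_diff_distrib eq_diff_eq add.commute)
  have "\<delta> = (1 - \<alpha>) * (1 - \<alpha>') * (y - z)"
    unfolding \<delta>_def \<beta> by (simp add: algebra_simps)
  ultimately show ?thesis using assms(3,7) by simp
qed

end

section \<open>Groups of affine permutations\<close>

text \<open>The type is repackaged as a ring record, so that the library theorem on the
  multiplicative group of a finite field applies.\<close>

lemma finite_field_generator:
  assumes fin: "finite (UNIV :: 'a::field set)"
  obtains g :: "'a::field" where "g \<noteq> 0" "\<And>x. x \<noteq> 0 \<Longrightarrow> \<exists>n::nat. x = g ^ n"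
proof -
  let ?R = "\<lparr>carrier = UNIV, monoid.mult = (*), one = 1, ring.zero = 0, add = (+)\<rparr> :: 'a ring"
  have R: "field ?R"
  proof -
    have "\<exists>y. x + y = 0" for x :: 'a using add.right_inverse by blast
    moreover have "x \<noteq> 0 \<Longrightarrow> \<exists>y. x * y = 1" for x :: 'a by (rule exI[of _ "inverse x"]) simp
    ultimately show ?thesis by unfold_locales (auto simp: algebra_simps Units_def)
  qed
  have carr: "carrier ?R = UNIV" and mul: "x \<otimes>\<^bsub>?R\<^esub> y = x * y" and zero: "\<zero>\<^bsub>?R\<^esub> = 0"
    and one: "\<one>\<^bsub>?R\<^esub> = 1" for x y
    by simp_all
  have pow: "x [^]\<^bsub>?R\<^esub> n = x ^ n" for x and n :: nat
    by (induction n) (simp_all add: one mul mult.commute)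
  have "\<exists>g \<in> UNIV - {0::'a}. UNIV - {0} = {g ^ i | i::nat. i \<in> UNIV}"
    using field.finite_field_mult_group_has_gen[OF R] fin
    unfolding Multiplicative_Group.carrier_mult_of carr zero pow by simp
  then obtain g :: 'a where g: "g \<noteq> 0" "UNIV - {0} = {g ^ i | i::nat. i \<in> UNIV}" by blast
  have "\<exists>n::nat. x = g ^ n" if "x \<noteq> 0" for x
  proof -
    have "x \<in> {g ^ i | i::nat. i \<in> UNIV}" using g(2) that by blast
    then show ?thesis by blast
  qed
  with g(1) show thesis by (rule that)
qed

text \<open>If \<open>g\<close> generates the whole multiplicative group, then \<open>g ^ k\<close>
  with the least positive \<open>k\<close> such that \<open>g ^ k \<in> H\<close> generates
  \<open>H\<close>. Closure under products suffices: by finiteness an inverse is a power.\<close>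

lemma finite_field_subgroup_generator:
  fixes H :: "'a::field set"
  assumes fin: "finite (UNIV :: 'a set)" and "1 \<in> H" "0 \<notin> H"
    and mult: "\<And>x y. x \<in> H \<Longrightarrow> y \<in> H \<Longrightarrow> x * y \<in> H"
  obtains c where "c \<in> H" "\<And>x. x \<in> H \<Longrightarrow> \<exists>n::nat. x = c ^ n"
proof -
  obtain g :: 'a where g: "g \<noteq> 0" "\<And>x. x \<noteq> 0 \<Longrightarrow> \<exists>n::nat. x = g ^ n"
    using finite_field_generator[OF fin] by blast
  have inverse_mem: "inverse x \<in> H" if "x \<in> H" for x
  proof -
    have x0: "x \<noteq> 0" using that \<open>0 \<notin> H\<close> by auto
    have "x ^ n \<in> H" for n by (induction n) (auto simp: \<open>1 \<in> H\<close> mult that)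
    moreover have "CARD('a) \<ge> 2"
      using card_mono[OF fin, of "{0, 1::'a}"] by simp
    then obtain k where k: "CARD('a) = Suc (Suc k)"
      using le_Suc_ex[of 2 "CARD('a)"] by auto
    have "x * x ^ k = 1"
      using finite_field_power_card[OF fin, of x] x0 unfolding k by simp
    then have "inverse x = x ^ k" by (rule inverse_unique)
    ultimately show ?thesis by simp
  qed
  define k where "k = (LEAST n::nat. n > 0 \<and> g ^ n \<in> H)"
  \<comment> \<open>This provides a positive exponent with power in \<open>H\<close>, so that the
    least one exists.\<close>
  have "g ^ (CARD('a) - 1) = 1"
  proof -
    have "CARD('a) = Suc (CARD('a) - 1)" using fin by (simp add: card_gt_0_iff)
    then have "g * g ^ (CARD('a) - 1) = g"
      using finite_field_power_card[OF fin, of g] by (metis power_Suc)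
    then show ?thesis using g by simp
  qed
  moreover have "CARD('a) - 1 > 0"
    using card_mono[OF fin, of "{0, 1::'a}"] by simp
  ultimately have "\<exists>n>0. g ^ n \<in> H" using \<open>1 \<in> H\<close> by metis
  then have k: "k > 0" "g ^ k \<in> H"
    using LeastI_ex[of "\<lambda>n. n > 0 \<and> g ^ n \<in> H"] unfolding k_def by auto
  have least: "n = 0" if "g ^ n \<in> H" "n < k" for n
    using not_less_Least[of n "\<lambda>n. n > 0 \<and> g ^ n \<in> H"] that unfolding k_def by auto
  have "\<exists>n. x = (g ^ k) ^ n" if x: "x \<in> H" for x
  proof -
    obtain i where i: "x = g ^ i" using g x \<open>0 \<notin> H\<close> by metis
    have pk: "(g ^ k) ^ n \<in> H" for n by (induction n) (auto simp: \<open>1 \<in> H\<close> mult k)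
    \<comment> \<open>Division with remainder: the factor with exponent \<open>i mod k\<close> lies
      in \<open>H\<close>, so minimality of \<open>k\<close> makes that exponent 0.\<close>
    have "x = (g ^ k) ^ (i div k) * g ^ (i mod k)"
      unfolding i power_mult[symmetric] power_add[symmetric] by simp
    then have "g ^ (i mod k) = x * inverse ((g ^ k) ^ (i div k))"
      using g by (simp add: field_simps)
    also have "\<dots> \<in> H" using x pk inverse_mem mult by blast
    finally have "i mod k = 0" using least k by simp
    then show ?thesis using \<open>x = _ * _\<close> by (metis mult.right_neutral power_0)
  qed
  then show thesis using that k by blast
qed

section \<open>Permutations that are affine in a coordinate\<close>

definition affine_on :: "'p set \<Rightarrow> ('p \<Rightarrow> 'a::field) \<Rightarrow> ('p \<Rightarrow> 'p) \<Rightarrow> bool" where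
  "affine_on b t g \<longleftrightarrow> (\<exists>\<alpha> \<beta>. \<alpha> \<noteq> 0 \<and> (\<forall>x\<in>b. t (g x) = \<alpha> * t x + \<beta>))"

lemma mult_BijGroup:
  "g \<in> Bij b \<Longrightarrow> h \<in> Bij b \<Longrightarrow> g \<otimes>\<^bsub>BijGroup b\<^esub> h = compose b g h"
  by (simp add: BijGroup_def)

lemma affine_on_compose:
  assumes "affine_on b t g" "affine_on b t h" "h \<in> Bij b"
  shows "affine_on b t (compose b g h)"
proof -
  obtain \<alpha> \<beta> where g: "\<alpha> \<noteq> 0" "\<forall>x\<in>b. t (g x) = \<alpha> * t x + \<beta>"
    using assms(1) by (auto simp: affine_on_def)
  obtain \<alpha>' \<beta>' where h: "\<alpha>' \<noteq> 0" "\<forall>x\<in>b. t (h x) = \<alpha>' * t x + \<beta>'"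
    using assms(2) by (auto simp: affine_on_def)
  have "h x \<in> b" if "x \<in> b" for x using assms(3) that Bij_imp_funcset by fastforce
  then have "\<forall>x\<in>b. t (compose b g h x) = (\<alpha> * \<alpha>') * t x + (\<alpha> * \<beta>' + \<beta>)"
    using g h by (simp add: compose_eq algebra_simps)
  then show ?thesis unfolding affine_on_def using g h by (metis mult_eq_0_iff)
qed

lemma affine_on_inverse:
  assumes "affine_on b t g" "g \<in> Bij b"
  shows "affine_on b t (inv\<^bsub>BijGroup b\<^esub> g)"
proof -
  interpret G: group "BijGroup b" by (rule group_BijGroup)
  have carr: "carrier (BijGroup b) = Bij b" by (simp add: BijGroup_def)
  let ?h = "inv\<^bsub>BijGroup b\<^esub> g"
  have h: "?h \<in> Bij b" using G.inv_closed assms(2) carr by simp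
  have "compose b g ?h = (\<lambda>x\<in>b. x)"
    using G.r_inv[of g] assms(2) h carr by (simp add: BijGroup_def)
  then have gh: "g (?h x) = x" if "x \<in> b" for x using that by (metis compose_eq restrict_apply')
  have hx: "?h x \<in> b" if "x \<in> b" for x using h that Bij_imp_funcset by fastforce
  obtain \<alpha> \<beta> where g: "\<alpha> \<noteq> 0" "\<forall>x\<in>b. t (g x) = \<alpha> * t x + \<beta>"
    using assms(1) by (auto simp: affine_on_def)
  have "\<forall>x\<in>b. t (?h x) = inverse \<alpha> * t x + (- \<beta> / \<alpha>)"
  proof
    fix x assume x: "x \<in> b"
    have "t x = \<alpha> * t (?h x) + \<beta>" using g gh hx x by metis
    then show "t (?h x) = inverse \<alpha> * t x + (- \<beta> / \<alpha>)" using g by (simp add: field_simps)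
  qed
  then show ?thesis unfolding affine_on_def using g by (metis inverse_nonzero_iff_nonzero)
qed

text \<open>Affine permutations are closed under products and inverses, so the property passes from
  the generators to the group by induction.\<close>

lemma affine_on_generate:
  assumes "A \<subseteq> Bij b" "\<And>g. g \<in> A \<Longrightarrow> affine_on b t g" "g \<in> generate (BijGroup b) A"
  shows "affine_on b t g"
proof -
  interpret G: group "BijGroup b" by (rule group_BijGroup)
  have carr: "carrier (BijGroup b) = Bij b" by (simp add: BijGroup_def)
  have sub: "generate (BijGroup b) A \<subseteq> Bij b"
    using G.generate_incl[of A] assms(1) carr by simp
  show ?thesis using assms(3)
  proof (induction rule: generate.induct)
    case one
    have "\<forall>x\<in>b. t (\<one>\<^bsub>BijGroup b\<^esub> x) = 1 * t x + 0" by (simp add: BijGroup_def)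
    then show ?case unfolding affine_on_def by (metis one_neq_zero)
  next
    case (incl h)
    then show ?case using assms(2) by simp
  next
    case (inv h)
    then show ?case using assms(1,2) by (auto intro: affine_on_inverse)
  next
    case (eng h1 h2)
    then have "h1 \<in> Bij b" "h2 \<in> Bij b" using sub by auto
    then show ?case using eng by (simp add: mult_BijGroup affine_on_compose)
  qed
qed

locale affine_permutations =
  fixes q :: nat and b :: "'p set" and t :: "'p \<Rightarrow> 'a::field" and H :: "('p \<Rightarrow> 'p) set"
  assumes card_field: "CARD('a) = q ^ 2" and q_pos: "q \<ge> 1" and card_b: "card b = q + 1"
    and inj_t: "inj_on t b" and H: "subgroup H (BijGroup b)"
    and affine: "\<And>g. g \<in> H \<Longrightarrow> affine_on b t g"
begin

sublocale S: affine_set q "t ` b"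
  using card_field q_pos card_b inj_t by unfold_locales (auto simp: card_image)

lemma H_Bij: "g \<in> H \<Longrightarrow> g \<in> Bij b"
  using subgroup.subset[OF H] by (auto simp: BijGroup_def)

lemma H_closed: "g \<in> H \<Longrightarrow> x \<in> b \<Longrightarrow> g x \<in> b"
  using H_Bij Bij_imp_funcset by fastforce

text \<open>Elements of \<open>Bij b\<close> are extensional, so their values on \<open>b\<close>
  determine them, and \<open>t\<close> separates these values.\<close>

lemma eq_if_affine_eq:
  assumes "g \<in> H" "h \<in> H" "\<And>x. x \<in> b \<Longrightarrow> t (g x) = t (h x)"
  shows "g = h"
proof (rule extensionalityI[of _ b])
  show "g \<in> extensional b" "h \<in> extensional b"
    using assms H_Bij Bij_imp_extensional by auto
  show "g x = h x" if "x \<in> b" for x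
    using assms(3)[OF that] inj_t H_closed assms(1,2) that by (auto simp: inj_on_def)
qed

lemma one_mem: "(\<lambda>x\<in>b. x) \<in> H"
  using subgroup.one_closed[OF H] by (simp add: BijGroup_def)

text \<open>A fixed point in \<open>b\<close> forces slope 1; what remains is a translation
  preserving the coordinates of \<open>b\<close>, hence trivial.\<close>

lemma fixed_point_imp_id:
  assumes g: "g \<in> H" and x: "x \<in> b" "g x = x"
  shows "g = (\<lambda>x\<in>b. x)"
proof -
  obtain \<alpha> \<beta> where ab: "\<alpha> \<noteq> 0" "\<forall>x\<in>b. t (g x) = \<alpha> * t x + \<beta>"
    using affine[OF g] by (auto simp: affine_on_def)
  have S: "\<alpha> * y + \<beta> \<in> t ` b" if y: "y \<in> t ` b" for y
  proof -
    obtain x where "x \<in> b" "y = t x" using y by blast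
    then have "\<alpha> * y + \<beta> = t (g x)" "g x \<in> b" using ab H_closed[OF g] by auto
    then show ?thesis by simp
  qed
  have "\<alpha> * t x + \<beta> = t x" using ab(2) x by force
  then have "\<alpha> = 1"
    using S.fixed_point_trivial[OF ab(1) S imageI[OF x(1)]] by simp
  moreover from this have "\<beta> = 0"
    using S.translation_trivial[of \<beta>] S by simp
  ultimately show ?thesis
    using ab by (intro eq_if_affine_eq[OF g one_mem]) simp
qed

lemma semi_regular: "semi_regular_on b ((BijGroup b)\<lparr>carrier := H\<rparr>)"
proof -
  let ?G = "(BijGroup b)\<lparr>carrier := H\<rparr>"
  have one: "\<one>\<^bsub>?G\<^esub> = (\<lambda>x\<in>b. x)" by (simp add: BijGroup_def)
  have "stabilizer ?G (\<lambda>g. g) x = {\<one>\<^bsub>?G\<^esub>}" if x: "x \<in> b" for x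
  proof (intro equalityI subsetI)
    fix g assume "g \<in> stabilizer ?G (\<lambda>g. g) x"
    then have "g \<in> H" "g x = x" by (simp_all add: stabilizer_def)
    then show "g \<in> {\<one>\<^bsub>?G\<^esub>}" unfolding one using fixed_point_imp_id x by simp
  next
    fix g assume "g \<in> {\<one>\<^bsub>?G\<^esub>}"
    then have "g = (\<lambda>x\<in>b. x)" unfolding one by simp
    then show "g \<in> stabilizer ?G (\<lambda>g. g) x" using one_mem x by (simp add: stabilizer_def)
  qed
  then show ?thesis unfolding semi_regular_on_def by simp
qed

text \<open>Sending an element to its slope is multiplicative and injective. The slopes thus form a
  multiplicatively closed set of nonzero field elements, and an element whose slope generates this
  set generates \<open>H\<close>.\<close>

lemma cyclic: "cyclic_group ((BijGroup b)\<lparr>carrier := H\<rparr>)"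
proof -
  let ?G = "(BijGroup b)\<lparr>carrier := H\<rparr>"
  interpret G: group ?G using subgroup.subgroup_is_group[OF H group_BijGroup] .
  define slope where "slope g \<alpha> \<longleftrightarrow> \<alpha> \<noteq> 0 \<and> (\<exists>\<beta>. \<forall>x\<in>b. t (g x) = \<alpha> * t x + \<beta>)" for g \<alpha>
  define M where "M = {\<alpha>. \<exists>g\<in>H. slope g \<alpha>}"
  have mult: "g \<otimes>\<^bsub>?G\<^esub> h = compose b g h" if "g \<in> H" "h \<in> H" for g h
    using that H_Bij by (simp add: BijGroup_def)
  have slope_one: "slope (\<lambda>x\<in>b. x) 1"
    unfolding slope_def by (auto intro: exI[of _ 0])
  have slope_mult: "slope (g \<otimes>\<^bsub>?G\<^esub> h) (\<alpha> * \<alpha>')"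
    if "g \<in> H" "h \<in> H" "slope g \<alpha>" "slope h \<alpha>'" for g h \<alpha> \<alpha>'
  proof -
    obtain \<beta> \<beta>' where ab: "\<forall>x\<in>b. t (g x) = \<alpha> * t x + \<beta>" "\<forall>x\<in>b. t (h x) = \<alpha>' * t x + \<beta>'"
      using \<open>slope g \<alpha>\<close> \<open>slope h \<alpha>'\<close> unfolding slope_def by blast
    have "\<forall>x\<in>b. t (compose b g h x) = (\<alpha> * \<alpha>') * t x + (\<alpha> * \<beta>' + \<beta>)"
      using ab H_closed[OF \<open>h \<in> H\<close>] by (simp add: compose_eq algebra_simps)
    then show ?thesis
      using \<open>slope g \<alpha>\<close> \<open>slope h \<alpha>'\<close> mult[OF that(1,2)] unfolding slope_def by auto
  qed
  have slope_inj: "g = h" if gh: "g \<in> H" "h \<in> H" "slope g \<alpha>" "slope h \<alpha>" for g h \<alpha>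
  proof -
    obtain \<beta> \<beta>' where ab: "\<forall>x\<in>b. t (g x) = \<alpha> * t x + \<beta>" "\<forall>x\<in>b. t (h x) = \<alpha> * t x + \<beta>'"
      using gh unfolding slope_def by blast
    \<comment> \<open>Two elements of equal slope differ by the translation by
      \<open>\<beta> - \<beta>'\<close>; since \<open>h\<close> is onto \<open>b\<close>, that
      translation preserves the coordinates of \<open>b\<close>.\<close>
    have "y + (\<beta> - \<beta>') \<in> t ` b" if y: "y \<in> t ` b" for y
    proof -
      have "h ` b = b" using H_Bij[OF \<open>h \<in> H\<close>] by (simp add: Bij_def bij_betw_def)
      then have "y \<in> t ` h ` b" using y by simp
      then obtain x where x: "x \<in> b" "y = t (h x)" by (auto elim!: imageE)
      then have "y + (\<beta> - \<beta>') = t (g x)" using ab by simp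
      then show ?thesis using H_closed \<open>g \<in> H\<close> x by auto
    qed
    then have "\<beta> = \<beta>'" using S.translation_trivial[of "\<beta> - \<beta>'"] by simp
    then show ?thesis using ab by (intro eq_if_affine_eq[OF gh(1,2)]) simp
  qed
  have "1 \<in> M" using slope_one one_mem unfolding M_def by blast
  moreover have "0 \<notin> M" unfolding M_def slope_def by simp
  moreover have "x * y \<in> M" if xy: "x \<in> M" "y \<in> M" for x y
  proof -
    obtain g h where gh: "g \<in> H" "h \<in> H" "slope g x" "slope h y"
      using xy unfolding M_def by blast
    have "g \<otimes>\<^bsub>?G\<^esub> h \<in> H" using G.m_closed[of g h] gh by simp
    then show ?thesis using slope_mult[OF gh] unfolding M_def by blast
  qed
  ultimately obtain c where c: "c \<in> M" "\<And>x. x \<in> M \<Longrightarrow> \<exists>n::nat. x = c ^ n"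
    using finite_field_subgroup_generator[OF S.finite_field, of M] by metis
  obtain g where g: "g \<in> H" "slope g c" using c unfolding M_def by auto
  have pow_mem: "g [^]\<^bsub>?G\<^esub> n \<in> H" for n :: nat using G.nat_pow_closed[of g n] g by simp
  have pow: "slope (g [^]\<^bsub>?G\<^esub> n) (c ^ n)" for n :: nat
  proof (induction n)
    case 0
    have "g [^]\<^bsub>?G\<^esub> (0::nat) = (\<lambda>x\<in>b. x)" by (simp add: BijGroup_def)
    then show ?case using slope_one by (simp only: power_0)
  next
    case (Suc n)
    then show ?case using slope_mult[OF pow_mem g(1) Suc g(2)] by (simp add: mult.commute)
  qed
  have "H = range (\<lambda>n::int. g [^]\<^bsub>?G\<^esub> n)"
  proof
    show "H \<subseteq> range (\<lambda>n::int. g [^]\<^bsub>?G\<^esub> n)"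
    proof
      fix h assume h: "h \<in> H"
      obtain \<alpha> where \<alpha>: "slope h \<alpha>" using affine[OF h] unfolding affine_on_def slope_def by auto
      then obtain n :: nat where "\<alpha> = c ^ n" using c h unfolding M_def by blast
      then have "h = g [^]\<^bsub>?G\<^esub> n" using slope_inj[OF h pow_mem] \<alpha> pow by simp
      then have "h = g [^]\<^bsub>?G\<^esub> (int n)" by (simp add: int_pow_int)
      then show "h \<in> range (\<lambda>n::int. g [^]\<^bsub>?G\<^esub> n)" by blast
    qed
    show "range (\<lambda>n::int. g [^]\<^bsub>?G\<^esub> n) \<subseteq> H" using G.int_pow_closed[of g] g by auto
  qed
  then show ?thesis using G.cyclic_group g by auto
qed

end

section \<open>Unitals\<close>

locale unital =
  fixes q :: nat and X :: "'p set" and B :: "'p set set"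
  assumes unital: "abstract_unital q X B" and q_ge_2: "q \<ge> 2"
begin

lemma finite_X: "finite X" and card_X: "card X = q ^ 3 + 1"
  and block_subset: "b \<in> B \<Longrightarrow> b \<subseteq> X" and card_block: "b \<in> B \<Longrightarrow> card b = q + 1"
  using unital by (auto simp: abstract_unital_def design2_def)

lemma finite_block: "b \<in> B \<Longrightarrow> finite b"
  using block_subset finite_X finite_subset by blast

lemma ex1_block:
  assumes "P \<in> X" "Q \<in> X" "P \<noteq> Q"
  shows "\<exists>!b. b \<in> B \<and> P \<in> b \<and> Q \<in> b"
proof -
  have "card {b \<in> B. P \<in> b \<and> Q \<in> b} = 1"
    using unital assms by (simp add: abstract_unital_def design2_def)
  then obtain b where "{b \<in> B. P \<in> b \<and> Q \<in> b} = {b}" by (rule card_1_singletonE)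
  then have "c \<in> B \<and> P \<in> c \<and> Q \<in> c \<longleftrightarrow> c = b" for c by (simp add: set_eq_iff)
  then show ?thesis by simp
qed

lemma block_through:
  assumes "P \<in> X" "Q \<in> X" "P \<noteq> Q"
  shows "block_through B P Q \<in> B" "P \<in> block_through B P Q" "Q \<in> block_through B P Q"
  using theI'[OF ex1_block[OF assms]] unfolding block_through_def by auto

lemma block_eqI:
  assumes "b \<in> B" "c \<in> B" "P \<in> b" "Q \<in> b" "P \<in> c" "Q \<in> c" "P \<noteq> Q"
  shows "b = c"
proof -
  have "P \<in> X" "Q \<in> X" using assms block_subset by auto
  then show ?thesis using ex1_block[of P Q] assms by blast
qed

lemma block_through_eqI:
  assumes "b \<in> B" "P \<in> b" "Q \<in> b" "P \<noteq> Q"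
  shows "block_through B P Q = b"
proof -
  have "P \<in> X" "Q \<in> X" using assms block_subset by auto
  then show ?thesis
    using block_through[of P Q] assms by (intro block_eqI[of _ _ P Q]) auto
qed

section \<open>Counting blocks through a point\<close>

text \<open>The blocks through \<open>P\<close>, with \<open>P\<close> removed, partition the other
  \<open>q ^ 3\<close> points into classes of size \<open>q\<close>.\<close>

lemma card_blocks_through:
  assumes P: "P \<in> X"
  shows "card {b \<in> B. P \<in> b} = q ^ 2"
proof -
  let ?A = "{b \<in> B. P \<in> b}"
  have "?A \<subseteq> Pow X" using block_subset by auto
  then have fin: "finite ?A" by (rule finite_subset) (simp add: finite_X)
  have "X - {P} = (\<Union>b\<in>?A. b - {P})"
  proof
    show "X - {P} \<subseteq> (\<Union>b\<in>?A. b - {P})"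
    proof
      fix Q assume "Q \<in> X - {P}"
      then show "Q \<in> (\<Union>b\<in>?A. b - {P})" using block_through[of P Q] P by auto
    qed
    show "(\<Union>b\<in>?A. b - {P}) \<subseteq> X - {P}" using block_subset by auto
  qed
  then have "card (X - {P}) = card (\<Union>b\<in>?A. b - {P})" by simp
  also have "\<dots> = (\<Sum>b\<in>?A. card (b - {P}))"
  proof (rule card_UN_disjoint[OF fin])
    show "\<forall>b\<in>?A. finite (b - {P})" using finite_block by auto
    show "\<forall>b\<in>?A. \<forall>c\<in>?A. b \<noteq> c \<longrightarrow> (b - {P}) \<inter> (c - {P}) = {}"
      using block_eqI[of _ _ P] by blast
  qed
  also have "\<dots> = (\<Sum>b\<in>?A. q)"
    using card_block finite_block by (intro sum.cong) auto
  finally have "q ^ 3 = card ?A * q" using P finite_X card_X by simp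
  then show ?thesis using q_ge_2 by (simp add: power2_eq_square power3_eq_cube)
qed

text \<open>Joining \<open>P\<close> to the \<open>q + 1\<close> points of \<open>b\<close> yields
  distinct blocks: one sharing two points with \<open>b\<close> would be \<open>b\<close> itself,
  which omits \<open>P\<close>.\<close>

lemma card_blocks_meeting:
  assumes b: "b \<in> B" and P: "P \<in> X" "P \<notin> b"
  shows "card {c \<in> B. P \<in> c \<and> c \<inter> b \<noteq> {}} = q + 1"
proof -
  have PQ: "block_through B P Q \<in> B" "P \<in> block_through B P Q" "Q \<in> block_through B P Q"
    if "Q \<in> b" for Q
    using block_through[of P Q] that P block_subset[OF b] by auto
  have "{c \<in> B. P \<in> c \<and> c \<inter> b \<noteq> {}} = block_through B P ` b"
  proof (intro equalityI subsetI)
    fix c assume "c \<in> {c \<in> B. P \<in> c \<and> c \<inter> b \<noteq> {}}"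
    then obtain Q where Q: "c \<in> B" "P \<in> c" "Q \<in> c" "Q \<in> b" by blast
    then have "block_through B P Q = c" using P by (intro block_through_eqI) auto
    then show "c \<in> block_through B P ` b" using Q by auto
  next
    fix c assume "c \<in> block_through B P ` b"
    then show "c \<in> {c \<in> B. P \<in> c \<and> c \<inter> b \<noteq> {}}" using PQ by fastforce
  qed
  moreover have "inj_on (block_through B P) b"
  proof (rule inj_onI)
    fix Q R assume QR: "Q \<in> b" "R \<in> b" "block_through B P Q = block_through B P R"
    show "Q = R"
    proof (rule ccontr)
      assume "Q \<noteq> R"
      then have "block_through B P Q = b"
        using QR PQ[of Q] PQ[of R] b by (intro block_eqI[of _ _ Q R]) auto
      then show False using PQ(2)[of Q] QR P by simp
    qed
  qed
  ultimately show ?thesis using card_block[OF b] by (simp add: card_image)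
qed

lemma card_blocks_missing:
  assumes b: "b \<in> B" and P: "P \<in> X" "P \<notin> b"
  shows "card {c \<in> B. P \<in> c \<and> c \<inter> b = {}} = q ^ 2 - (q + 1)"
proof -
  have "{c \<in> B. P \<in> c} \<subseteq> Pow X" using block_subset by auto
  then have fin: "finite {c \<in> B. P \<in> c}" by (rule finite_subset) (simp add: finite_X)
  have "{c \<in> B. P \<in> c \<and> c \<inter> b = {}} = {c \<in> B. P \<in> c} - {c \<in> B. P \<in> c \<and> c \<inter> b \<noteq> {}}" by blast
  moreover have "finite {c \<in> B. P \<in> c \<and> c \<inter> b \<noteq> {}}" using fin by (rule rev_finite_subset) blast
  moreover have "{c \<in> B. P \<in> c \<and> c \<inter> b \<noteq> {}} \<subseteq> {c \<in> B. P \<in> c}" by blast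
  ultimately show ?thesis
    using card_blocks_through[OF P(1)] card_blocks_meeting[OF assms] by (simp add: card_Diff_subset)
qed

lemma ex_block_missing:
  assumes b: "b \<in> B" and P: "P \<in> X" "P \<notin> b"
  obtains c where "c \<in> B" "P \<in> c" "c \<inter> b = {}"
proof -
  have "q * q \<ge> 2 * q" using q_ge_2 by (rule mult_right_mono) simp
  then have "q ^ 2 > q + 1"
  proof (cases "q = 2")
    case False
    then show ?thesis using \<open>q * q \<ge> 2 * q\<close> q_ge_2 unfolding power2_eq_square by linarith
  qed simp
  then have "card {c \<in> B. P \<in> c \<and> c \<inter> b = {}} \<noteq> 0" using card_blocks_missing[OF assms] by simp
  then have "{c \<in> B. P \<in> c \<and> c \<inter> b = {}} \<noteq> {}" by (metis card.empty)
  then show thesis using that by blast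
qed

text \<open>For \<open>q \<ge> 3\<close>, at most \<open>2 * (q + 1) < q ^ 2\<close> blocks through
  a point \<open>P\<close> off both blocks meet one of them. For \<open>q = 2\<close> this bound
  fails, but then exactly one block through each point off \<open>b1\<close> misses
  \<open>b1\<close>; the one through \<open>P\<close> differs from \<open>b2\<close> and so cannot
  meet it.\<close>

lemma ex_block_missing_two:
  assumes b: "b1 \<in> B" "b2 \<in> B" "b1 \<inter> b2 = {}"
  obtains c where "c \<in> B" "c \<inter> b1 = {}" "c \<inter> b2 = {}"
proof -
  \<comment> \<open>The bound \<open>4 * q \<le> q ^ 3\<close> shows that the at most
    \<open>2 * q + 2\<close> points of the two blocks do not exhaust \<open>X\<close>.\<close>
  have "2 * 2 \<le> q * q" using q_ge_2 by (intro mult_le_mono)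
  then have q2: "4 * q \<le> q ^ 3" unfolding power3_eq_cube by (intro mult_le_mono1) simp
  have "card (b1 \<union> b2) \<le> 2 * q + 2"
    using card_Un_le[of b1 b2] card_block b by simp
  also have "\<dots> < card X" using q2 q_ge_2 card_X by linarith
  finally have "\<not> X \<subseteq> b1 \<union> b2"
    using b finite_block by (meson card_mono finite_UnI not_le)
  then obtain P where P: "P \<in> X" "P \<notin> b1" "P \<notin> b2" by blast
  show thesis
  proof (cases "q = 2")
    case True
    obtain c where c: "c \<in> B" "P \<in> c" "c \<inter> b1 = {}"
      using ex_block_missing[OF b(1) P(1,2)] .
    have "c \<inter> b2 = {}"
    proof (rule ccontr)
      assume "c \<inter> b2 \<noteq> {}"
      then obtain R where R: "R \<in> c" "R \<in> b2" by blast
      then have "R \<in> X" "R \<notin> b1" using b block_subset by auto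
      then have "card {d \<in> B. R \<in> d \<and> d \<inter> b1 = {}} = 1"
        using card_blocks_missing[OF b(1)] True by simp
      then obtain d where "{d \<in> B. R \<in> d \<and> d \<inter> b1 = {}} = {d}" by (rule card_1_singletonE)
      moreover have "c \<in> {d \<in> B. R \<in> d \<and> d \<inter> b1 = {}}" "b2 \<in> {d \<in> B. R \<in> d \<and> d \<inter> b1 = {}}"
        using R c b by auto
      ultimately have "c = b2" by auto
      then show False using c P by simp
    qed
    then show thesis using that c by blast
  next
    case False
    then have "q \<ge> 3" using q_ge_2 by simp
    then have "q * q \<ge> 3 * q" by (rule mult_right_mono) simp
    moreover have "3 * q > 2 * (q + 1)" using \<open>q \<ge> 3\<close> by simp
    ultimately have q3: "q ^ 2 > 2 * (q + 1)" unfolding power2_eq_square by linarith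
    let ?A = "{c \<in> B. P \<in> c \<and> c \<inter> b1 \<noteq> {}} \<union> {c \<in> B. P \<in> c \<and> c \<inter> b2 \<noteq> {}}"
    have "?A \<subseteq> Pow X" using block_subset by auto
    then have fin: "finite ?A" by (rule finite_subset) (simp add: finite_X)
    have "card ?A \<le> 2 * (q + 1)"
      using card_Un_le[of "{c \<in> B. P \<in> c \<and> c \<inter> b1 \<noteq> {}}" "{c \<in> B. P \<in> c \<and> c \<inter> b2 \<noteq> {}}"]
        card_blocks_meeting[OF b(1) P(1,2)] card_blocks_meeting[OF b(2) P(1,3)] by simp
    then have "\<not> {c \<in> B. P \<in> c} \<subseteq> ?A"
      using card_mono[OF fin, of "{c \<in> B. P \<in> c}"] card_blocks_through[OF P(1)] q3 by auto
    then show thesis using that by blast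
  qed
qed

end

section \<open>Coordinates for a pair of disjoint blocks\<close>

text \<open>In suitable homogeneous coordinates the lines of \<open>b1\<close> and \<open>b2\<close> are \<open>z = 0\<close> and \<open>y = 0\<close>.
  A point \<open>Q\<close> of \<open>b1\<close> is \<open>(t Q : 1 : 0)\<close>, a point \<open>R\<close> of \<open>b2\<close> is \<open>(s R : 0 : 1)\<close>, and any other
  point \<open>P\<close> of \<open>X\<close> is \<open>(t P : 1 : - m P)\<close>.\<close>

locale unital_coordinates = unital q X B for q and X :: "'p set" and B +
  fixes b1 b2 :: "'p set" and t s m :: "'p \<Rightarrow> 'a::field"
  assumes card_field: "CARD('a) = q ^ 2"
    and b1: "b1 \<in> B" and b2: "b2 \<in> B" and disjoint: "b1 \<inter> b2 = {}"
    and inj_t: "inj_on t b1"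
    and m_nonzero: "P \<in> X - (b1 \<union> b2) \<Longrightarrow> m P \<noteq> 0"
    and collinear: "c \<in> B \<Longrightarrow> P \<in> c - (b1 \<union> b2) \<Longrightarrow> Q \<in> c \<inter> b1 \<Longrightarrow> R \<in> c \<inter> b2 \<Longrightarrow>
      t Q = t P + m P * s R"
    and coordinates_eqD: "P \<in> X - (b1 \<union> b2) \<Longrightarrow> Q \<in> X - (b1 \<union> b2) \<Longrightarrow>
      t P = t Q \<Longrightarrow> m P = m Q \<Longrightarrow> P = Q"
    and mem_line: "c \<in> B \<Longrightarrow> P \<in> c - (b1 \<union> b2) \<Longrightarrow> Q \<in> c - (b1 \<union> b2) \<Longrightarrow> P \<noteq> Q \<Longrightarrow>
      R \<in> X - (b1 \<union> b2) \<Longrightarrow> x = t P + m P * y \<Longrightarrow> x = t Q + m Q * y \<Longrightarrow> x = t R + m R * y \<Longrightarrow>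
      R \<in> c"
begin

abbreviation F where "F \<equiv> full_points X B b1 b2"

sublocale S: affine_set q "t ` b1"
  using card_field q_ge_2 card_block[OF b1] inj_t by unfold_locales (auto simp: card_image)

lemma full_pointD: "P \<in> F \<Longrightarrow> P \<in> X - (b1 \<union> b2)"
  by (simp add: full_points_def)

section \<open>Perspectivities in coordinates\<close>

text \<open>The block through \<open>P\<close> and \<open>Q\<close> differs from \<open>b2\<close>,
  since \<open>P\<close> is off \<open>b2\<close>, so it meets \<open>b2\<close> in a single point
  and the description operator is well defined.\<close>

lemma perspectivity:
  assumes P: "P \<in> F" and Q: "Q \<in> b1"
  shows "perspectivity B b1 P b2 Q \<in> b2"
    and "perspectivity B b1 P b2 Q \<in> block_through B P Q"
    and "t Q = t P + m P * s (perspectivity B b1 P b2 Q)"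
proof -
  note P' = full_pointD[OF P]
  let ?c = "block_through B P Q"
  have c: "?c \<in> B" "P \<in> ?c" "Q \<in> ?c" using block_through[of P Q] P' Q block_subset[OF b1] by auto
  obtain R where R: "R \<in> ?c" "R \<in> b2" using P Q unfolding full_points_def by blast
  have "R' = R" if "R' \<in> ?c \<inter> b2" for R'
  proof (rule ccontr)
    assume "R' \<noteq> R"
    then have "?c = b2" using that R c b2 by (intro block_eqI[of _ _ R R']) auto
    then show False using c P' by simp
  qed
  then have "(THE R. R \<in> ?c \<inter> b2) = R" using R by blast
  then have eq: "perspectivity B b1 P b2 Q = R" using Q by (simp add: perspectivity_def)
  show "perspectivity B b1 P b2 Q \<in> b2" "perspectivity B b1 P b2 Q \<in> ?c"
    "t Q = t P + m P * s (perspectivity B b1 P b2 Q)"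
    unfolding eq using R collinear[OF c(1), of P Q R] c P' Q by auto
qed

text \<open>The image of \<open>Q\<close> determines \<open>t Q\<close> and hence \<open>Q\<close>;
  the two blocks have equal size.\<close>

lemma bij_perspectivity:
  assumes P: "P \<in> F"
  shows "bij_betw (perspectivity B b1 P b2) b1 b2"
proof -
  have "inj_on (perspectivity B b1 P b2) b1"
  proof (rule inj_onI)
    fix Q R assume QR: "Q \<in> b1" "R \<in> b1" "perspectivity B b1 P b2 Q = perspectivity B b1 P b2 R"
    then have "t Q = t R" using perspectivity(3)[OF P] by metis
    then show "Q = R" using inj_t QR by (simp add: inj_on_eq_iff)
  qed
  moreover have "perspectivity B b1 P b2 ` b1 \<subseteq> b2" using perspectivity(1)[OF P] by blast
  ultimately show ?thesis
    using card_block[OF b1] card_block[OF b2] finite_block[OF b2]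
    by (simp add: bij_betw_def card_image card_subset_eq)
qed

text \<open>The block joining \<open>P\<close> to the image of \<open>Q\<close> is again the block
  through \<open>P\<close> and \<open>Q\<close>, and it meets \<open>b1\<close> only in
  \<open>Q\<close>.\<close>

lemma perspectivity_inverse:
  assumes P: "P \<in> F" and Q: "Q \<in> b1"
  shows "perspectivity B b2 P b1 (perspectivity B b1 P b2 Q) = Q"
proof -
  note P' = full_pointD[OF P]
  let ?c = "block_through B P Q" and ?R = "perspectivity B b1 P b2 Q"
  have c: "?c \<in> B" "P \<in> ?c" "Q \<in> ?c" using block_through[of P Q] P' Q block_subset[OF b1] by auto
  have R: "?R \<in> b2" "?R \<in> ?c" using perspectivity[OF P Q] by auto
  have cR: "block_through B P ?R = ?c" using c R P' by (intro block_through_eqI) auto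
  have "Q' = Q" if "Q' \<in> ?c \<inter> b1" for Q'
  proof (rule ccontr)
    assume "Q' \<noteq> Q"
    then have "?c = b1" using that Q c b1 by (intro block_eqI[of _ _ Q Q']) auto
    then show False using c P' by simp
  qed
  then have "(THE Q. Q \<in> ?c \<inter> b1) = Q" using c Q by blast
  then show ?thesis using R cR by (simp add: perspectivity_def)
qed

text \<open>Eliminating the \<open>s\<close>-coordinate of the intermediate point on
  \<open>b2\<close> from the collinearity equations for \<open>P\<close> and \<open>Q\<close> yields
  the affine formula.\<close>

lemma compose_perspectivities:
  assumes P: "P \<in> F" and Q: "Q \<in> F"
  defines "g \<equiv> compose b1 (perspectivity B b2 Q b1) (perspectivity B b1 P b2)"
  shows "g \<in> Bij b1"
    and "x \<in> b1 \<Longrightarrow> t (g x) = m Q / m P * t x + (t Q - m Q / m P * t P)"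
proof -
  let ?p = "perspectivity B b1 P b2" and ?r = "perspectivity B b1 Q b2"
    and ?r' = "perspectivity B b2 Q b1"
  have "bij_betw (inv_into b1 ?r) b2 b1" using bij_perspectivity[OF Q] by (rule bij_betw_inv_into)
  moreover have inv: "?r' y = inv_into b1 ?r y" if y: "y \<in> b2" for y
  proof -
    have "inv_into b1 ?r y \<in> b1" "?r (inv_into b1 ?r y) = y"
      using bij_perspectivity[OF Q] y by (auto simp: bij_betw_def f_inv_into_f inv_into_into)
    then show ?thesis using perspectivity_inverse[OF Q] by metis
  qed
  ultimately have "bij_betw ?r' b2 b1" by (simp cong: bij_betw_cong)
  then have "bij_betw g b1 b1"
    unfolding g_def using bij_perspectivity[OF P] bij_betw_compose by blast
  then show "g \<in> Bij b1" by (simp add: Bij_def g_def)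
  assume x: "x \<in> b1"
  have m: "m P \<noteq> 0" using m_nonzero full_pointD[OF P] by simp
  have "g x = ?r' (?p x)" using x by (simp add: g_def compose_eq)
  moreover have px: "?p x \<in> b2" using perspectivity(1)[OF P x] .
  moreover have "inv_into b1 ?r (?p x) \<in> b1" "?r (inv_into b1 ?r (?p x)) = ?p x"
    using bij_perspectivity[OF Q] px by (auto simp: bij_betw_def f_inv_into_f inv_into_into)
  ultimately have "t (g x) = t Q + m Q * s (?p x)"
    using perspectivity(3)[OF Q] inv by metis
  moreover have "s (?p x) = (t x - t P) / m P" using perspectivity(3)[OF P x] m by (simp add: field_simps)
  ultimately show "t (g x) = m Q / m P * t x + (t Q - m Q / m P * t P)"
    using m by (simp add: field_simps)
qed

lemma full_points_map:
  assumes P: "P \<in> F" and Q: "Q \<in> F" and x: "x \<in> t ` b1"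
  shows "m Q / m P * x + (t Q - m Q / m P * t P) \<in> t ` b1"
proof -
  let ?g = "compose b1 (perspectivity B b2 Q b1) (perspectivity B b1 P b2)"
  obtain y where y: "y \<in> b1" "x = t y" using x by blast
  have "?g y \<in> b1" using compose_perspectivities(1)[OF P Q] Bij_imp_funcset y by fastforce
  then show ?thesis using compose_perspectivities(2)[OF P Q y(1)] y by (metis imageI)
qed

section \<open>Full points lie on a common line\<close>

text \<open>Equal \<open>m\<close> means that the product is the translation by
  \<open>t Q - t P\<close>, which must be trivial. Geometrically, the line joining two full points
  misses the intersection of the lines of \<open>b1\<close> and \<open>b2\<close>.\<close>

lemma full_points_m_eqD:
  assumes P: "P \<in> F" and Q: "Q \<in> F" and "m P = m Q"
  shows "P = Q"
proof -
  have "m P \<noteq> 0" using m_nonzero full_pointD[OF P] by simp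
  then have "t Q - t P = 0"
    using full_points_map[OF P Q] \<open>m P = m Q\<close> by (intro S.translation_trivial) simp
  then show ?thesis using coordinates_eqD full_pointD P Q \<open>m P = m Q\<close> by simp
qed

text \<open>\<open>(x : 1 : 0)\<close> and \<open>(y : 0 : 1)\<close> are the points where the line \<open>PQ\<close> meets the lines of \<open>b1\<close>
  and \<open>b2\<close>; the former is the fixed point of the product of the perspectivities.\<close>

lemma full_points_join:
  assumes P: "P \<in> F" and Q: "Q \<in> F" and "P \<noteq> Q"
  obtains x y where "x = t P + m P * y" "x = t Q + m Q * y"
    "m Q / m P * x + (t Q - m Q / m P * t P) = x"
proof -
  have m: "m P \<noteq> 0" using m_nonzero full_pointD[OF P] by simp
  have d: "m P - m Q \<noteq> 0" using full_points_m_eqD assms by auto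
  \<comment> \<open>The solution of \<open>t P + m P * y = t Q + m Q * y\<close>.\<close>
  define y where "y = (t Q - t P) / (m P - m Q)"
  have y: "y * (m P - m Q) = t Q - t P" using d by (simp add: y_def)
  have eq: "t P + m P * y = t Q + m Q * y" using y by (simp add: algebra_simps)
  have "m Q / m P * (t P + m P * y) + (t Q - m Q / m P * t P) = t Q + m Q * y"
    using m by (simp add: field_simps)
  then show thesis using that[of "t P + m P * y" y] eq by simp
qed

text \<open>With no full point or just one, the block comes from counting; otherwise it is the block
  joining two full points.\<close>

lemma full_points_subset_block:
  obtains c where "c \<in> B" "c \<inter> b1 = {}" "c \<inter> b2 = {}" "F \<subseteq> c"
proof (cases "F = {}")
  case True
  obtain c where "c \<in> B" "c \<inter> b1 = {}" "c \<inter> b2 = {}"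
    using ex_block_missing_two[OF b1 b2 disjoint] .
  then show thesis using that True by simp
next
  case False
  then obtain P where P: "P \<in> F" by blast
  note P' = full_pointD[OF P]
  \<comment> \<open>The perspectivity from \<open>P\<close> is onto \<open>b2\<close>, so a block
    through \<open>P\<close> that misses \<open>b1\<close> also misses \<open>b2\<close>.\<close>
  have c_meet: "c \<inter> b1 \<noteq> {}" if c: "c \<in> B" "P \<in> c" "c \<inter> b2 \<noteq> {}" for c
  proof -
    obtain R where R: "R \<in> c" "R \<in> b2" using c by blast
    then obtain Q where Q: "Q \<in> b1" "R = perspectivity B b1 P b2 Q"
      using bij_perspectivity[OF P] by (auto simp: bij_betw_def)
    have "block_through B P Q \<in> B" "P \<in> block_through B P Q" "Q \<in> block_through B P Q"
      using block_through[of P Q] P' Q block_subset[OF b1] by auto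
    moreover have "R \<in> block_through B P Q" using perspectivity(2)[OF P] Q by simp
    ultimately have "block_through B P Q = c"
      using c R P' by (intro block_eqI[of _ _ P R]) auto
    then show ?thesis using \<open>Q \<in> block_through B P Q\<close> Q by blast
  qed
  show thesis
  proof (cases "F = {P}")
    case True
    obtain c where c: "c \<in> B" "P \<in> c" "c \<inter> b1 = {}"
      using ex_block_missing[OF b1, of P] P' by auto
    moreover from this have "c \<inter> b2 = {}" using c_meet[of c] by blast
    ultimately show thesis using that[of c] True by simp
  next
    case False
    then obtain Q where Q: "Q \<in> F" "Q \<noteq> P" using P by blast
    note Q' = full_pointD[OF Q(1)]
    let ?c = "block_through B P Q"
    have c: "?c \<in> B" "P \<in> ?c" "Q \<in> ?c" using block_through[of P Q] P' Q Q' by auto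
    obtain x y where xy: "x = t P + m P * y" "x = t Q + m Q * y"
      "m Q / m P * x + (t Q - m Q / m P * t P) = x"
      using full_points_join[OF P Q(1)] Q(2) by metis
    have m: "m P \<noteq> 0" "m Q \<noteq> 0" "m P \<noteq> m Q"
      using m_nonzero P' Q' full_points_m_eqD[OF P Q(1)] Q(2) by auto
    have "R \<in> ?c" if R: "R \<in> F" for R
    proof (cases "R = P")
      case True
      then show ?thesis using c by simp
    next
      case False
      note R' = full_pointD[OF R]
      obtain x' y' where xy': "x' = t P + m P * y'" "x' = t R + m R * y'"
        "m R / m P * x' + (t R - m R / m P * t P) = x'"
        using full_points_join[OF P R] False by metis
      have mR: "m R \<noteq> 0" "m P \<noteq> m R"
        using m_nonzero R' full_points_m_eqD[OF P R] False by auto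
      \<comment> \<open>\<open>x\<close> and \<open>x'\<close> are the fixed points of the products
        for \<open>P\<close>, \<open>Q\<close> and for \<open>P\<close>, \<open>R\<close>. Both have
        slope different from 1 and preserve the coordinates of \<open>b1\<close>, so they share
        their fixed point.\<close>
      have "x = x'"
        by (rule S.fixed_points_eq[OF _ full_points_map[OF P Q(1)] _ xy(3)
              _ full_points_map[OF P R] _ xy'(3)]) (use m mR in auto)
      moreover from this have "y = y'" using xy(1) xy'(1) m by simp
      ultimately show ?thesis
        using mem_line[OF c(1), of P Q R x y] c P' Q' R' Q(2) xy xy' by auto
    qed
    moreover have "?c \<inter> b1 = {}"
    proof (rule ccontr)
      \<comment> \<open>A point \<open>A\<close> of \<open>b1\<close> on the line \<open>PQ\<close>
        has coordinate \<open>x\<close>. The product then fixes an element of the coordinate set of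
        \<open>b1\<close>, so its slope is 1, contrary to \<open>m P \<noteq> m Q\<close>.\<close>
      assume "?c \<inter> b1 \<noteq> {}"
      then obtain A where A: "A \<in> ?c" "A \<in> b1" by blast
      define R where "R = perspectivity B b1 P b2 A"
      have "block_through B P A = ?c" using c A P' by (intro block_through_eqI) auto
      then have R: "R \<in> b2" "R \<in> ?c" using perspectivity[OF P A(2)] by (auto simp: R_def)
      have "t A = t P + m P * s R" "t A = t Q + m Q * s R"
        using collinear[OF c(1)] c P' Q' A R by auto
      moreover have "(m P - m Q) * z = t Q - t P" if "t P + m P * z = t Q + m Q * z" for z
        using that by (simp add: algebra_simps)
      ultimately have "(m P - m Q) * s R = (m P - m Q) * y" using xy(1,2) by simp
      then have "s R = y" using m by simp
      then have "t A = x" using \<open>t A = t P + m P * s R\<close> xy by simp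
      then have "x \<in> t ` b1" using A by blast
      then have "m Q / m P = 1"
        using S.fixed_point_trivial[OF _ full_points_map[OF P Q(1)] _ xy(3)] m by simp
      then show False using m by simp
    qed
    moreover from this have "?c \<inter> b2 = {}" using c_meet[of ?c] c by blast
    ultimately show thesis using that[of ?c] c by blast
  qed
qed

section \<open>The group of perspectivities\<close>

lemma persp_generators_affine:
  assumes "g \<in> persp_generators X B b2 b1"
  shows "g \<in> Bij b1" "affine_on b1 t g"
proof -
  obtain P Q where PQ: "P \<in> F" "Q \<in> F"
    and g: "g = compose b1 (perspectivity B b2 Q b1) (perspectivity B b1 P b2)"
    using assms unfolding persp_generators_def by blast
  show "g \<in> Bij b1" unfolding g by (rule compose_perspectivities(1)[OF PQ])
  have "m Q / m P \<noteq> 0" using m_nonzero full_pointD PQ by simp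
  then show "affine_on b1 t g"
    unfolding affine_on_def g using compose_perspectivities(2)[OF PQ] by blast
qed

lemma Persp_regular:
  "permutation_group_on b1 (Persp X B b2 b1) \<and> cyclic_group (Persp X B b2 b1) \<and>
   semi_regular_on b1 (Persp X B b2 b1)"
proof -
  let ?H = "generate (BijGroup b1) (persp_generators X B b2 b1)"
  have sub: "persp_generators X B b2 b1 \<subseteq> Bij b1" using persp_generators_affine(1) by blast
  then have H: "subgroup ?H (BijGroup b1)"
    by (intro group.generate_is_subgroup[OF group_BijGroup]) (simp add: BijGroup_def)
  interpret H: affine_permutations q b1 t ?H
    using card_field q_ge_2 card_block[OF b1] inj_t H
      affine_on_generate[OF sub persp_generators_affine(2)]
    by (intro affine_permutations.intro) auto
  show ?thesis
    using H H.cyclic H.semi_regular by (simp add: Persp_def permutation_group_on_def)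
qed

end

section \<open>Coordinates in the projective plane\<close>

text \<open>Take \<open>z\<close> in both planes, \<open>u\<close> only in \<open>L1\<close> and
  \<open>v\<close> only in \<open>L2\<close>. They form a basis, and \<open>T\<close> sends
  \<open>z\<close>, \<open>u\<close>, \<open>v\<close> to the first, second and third unit
  vectors.\<close>

lemma plane_coordinates:
  fixes L1 L2 :: "('a::field ^ 3) set"
  assumes L1: "vec.subspace L1" "vec.dim L1 = 2" and L2: "vec.subspace L2" "vec.dim L2 = 2"
    and "L1 \<noteq> L2"
  obtains T :: "'a ^ 3 \<Rightarrow> 'a ^ 3" where "Vector_Spaces.linear (*s) (*s) T" "inj T"
    "\<And>v. v \<in> L1 \<longleftrightarrow> T v $ 3 = 0" "\<And>v. v \<in> L2 \<longleftrightarrow> T v $ 2 = 0"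
proof -
  \<comment> \<open>By the dimension formula the intersection has dimension at least 2 + 2 - 3 =
    1.\<close>
  have "vec.dim {x + y |x y. x \<in> L1 \<and> y \<in> L2} \<le> 3"
    using dim_subset_UNIV_cart_gen[of "{x + y |x y. x \<in> L1 \<and> y \<in> L2}"] by simp
  then have "vec.dim (L1 \<inter> L2) \<noteq> 0"
    using vec.dim_sums_Int[OF L1(1) L2(1)] L1(2) L2(2) by linarith
  then obtain z where z: "z \<in> L1" "z \<in> L2" "z \<noteq> 0"
    using vec.dim_eq_0[of "L1 \<inter> L2"] by auto
  obtain u where u: "u \<in> L1" "u \<notin> L2"
    using vec.subspace_dim_equal[OF L1(1) L2(1)] assms by auto
  obtain v where v: "v \<in> L2" "v \<notin> L1"
    using vec.subspace_dim_equal[OF L2(1) L1(1)] assms by auto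
  have span_z: "vec.span {z} \<subseteq> L1" "vec.span {z} \<subseteq> L2"
    using vec.span_minimal[of "{z}"] z L1(1) L2(1) by simp_all
  have basis: "vec.independent {x, z}" "vec.span {x, z} = L"
    if L: "vec.subspace L" "vec.dim L = 2" "x \<in> L" "z \<in> L" "x \<notin> vec.span {z}" for x L
  proof -
    show ind: "vec.independent {x, z}"
      using L(5) z(3) by (intro vec.independent_insertI) (auto simp: vec.independent_empty)
    have "x \<noteq> z" using L(5) vec.span_base by auto
    then have "L \<subseteq> vec.span {x, z}"
      using L ind by (intro vec.card_ge_dim_independent) auto
    then show "vec.span {x, z} = L" using L vec.span_minimal[of "{x, z}" L] by auto
  qed
  have L1_eq: "vec.span {u, z} = L1" and L2_eq: "vec.span {v, z} = L2"
    and ind_uz: "vec.independent {u, z}"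
    using basis[of L1 u] basis[of L2 v] L1 L2 u v z span_z by blast+
  have ind: "vec.independent {v, u, z}"
    using v ind_uz L1_eq by (simp add: vec.independent_insertI)
  have ne: "v \<noteq> u" "v \<noteq> z" "u \<noteq> z" using u v z by auto
  have "UNIV \<subseteq> vec.span {v, u, z}"
    using ind ne by (intro vec.card_ge_dim_independent) (auto simp: card_cart_basis)
  then have decomp: "\<exists>a b c. x = a *s v + b *s u + c *s z" for x
  proof -
    have "x \<in> vec.span {v, u, z}" using \<open>UNIV \<subseteq> _\<close> by blast
    then obtain a b c where "x - a *s v - b *s u = c *s z"
      by (auto simp: vec.span_insert vec.span_singleton)
    then have "x = a *s v + b *s u + c *s z" by (simp add: algebra_simps)
    then show ?thesis by blast
  qed
  define f :: "'a ^ 3 \<Rightarrow> 'a ^ 3"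
    where "f x = (if x = v then axis 3 1 else if x = u then axis 2 1 else axis 1 1)" for x
  obtain T where T: "Vector_Spaces.linear (*s) (*s) T" "\<forall>x\<in>{v, u, z}. T x = f x"
    using vec.linear_independent_extend[OF ind, of f] by blast
  have Tv: "T v = axis 3 1" "T u = axis 2 1" "T z = axis 1 1" using T(2) ne by (auto simp: f_def)
  interpret T: Vector_Spaces.linear "(*s)" "(*s)" T by (rule T(1))
  have T_eq: "T (a *s v + b *s u + c *s z) = vector [c, b, a]" for a b c
    by (simp add: T.add T.scale Tv vec_eq_iff forall_3 axis_def)
  have mem1: "x \<in> L1 \<longleftrightarrow> T x $ 3 = 0" for x
  proof -
    obtain a b c where x: "x = a *s v + b *s u + c *s z" using decomp by blast
    have bc: "b *s u + c *s z \<in> L1"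
      using u z L1(1) by (intro vec.subspace_add vec.subspace_scale) auto
    show ?thesis
    proof
      assume "x \<in> L1"
      then have "x - (b *s u + c *s z) \<in> L1" using bc L1(1) vec.subspace_diff by blast
      then have "a *s v \<in> L1" by (simp add: x algebra_simps)
      then have "inverse a *s (a *s v) \<in> L1" using L1(1) vec.subspace_scale by blast
      then have "a = 0" using v by (cases "a = 0") auto
      then show "T x $ 3 = 0" unfolding x T_eq by simp
    next
      assume "T x $ 3 = 0"
      then have "a = 0" by (simp add: x T_eq)
      then show "x \<in> L1" using bc by (simp add: x)
    qed
  qed
  have mem2: "x \<in> L2 \<longleftrightarrow> T x $ 2 = 0" for x
  proof -
    obtain a b c where x: "x = a *s v + b *s u + c *s z" using decomp by blast
    have bc: "a *s v + c *s z \<in> L2"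
      using v z L2(1) by (intro vec.subspace_add vec.subspace_scale) auto
    show ?thesis
    proof
      assume "x \<in> L2"
      then have "x - (a *s v + c *s z) \<in> L2" using bc L2(1) vec.subspace_diff by blast
      then have "b *s u \<in> L2" by (simp add: x algebra_simps)
      then have "inverse b *s (b *s u) \<in> L2" using L2(1) vec.subspace_scale by blast
      then have "b = 0" using u by (cases "b = 0") auto
      then show "T x $ 2 = 0" unfolding x T_eq by simp
    next
      assume "T x $ 2 = 0"
      then have "b = 0" by (simp add: x T_eq)
      then show "x \<in> L2" using bc by (simp add: x)
    qed
  qed
  have "inj T"
  proof (rule injI)
    fix x y assume "T x = T y"
    obtain a b c where x: "x = a *s v + b *s u + c *s z" using decomp by blast
    obtain a' b' c' where y: "y = a' *s v + b' *s u + c' *s z" using decomp by blast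
    have "a = a'" "b = b'" "c = c'"
      using \<open>T x = T y\<close> unfolding x y T_eq by (auto simp: vec_eq_iff forall_3)
    then show "x = y" by (simp add: x y)
  qed
  then show thesis using that T(1) mem1 mem2 by blast
qed

section \<open>Homogeneous coordinates of points\<close>

text \<open>A choice of homogeneous coordinates; its arbitrary scalar factor cancels in the
  quotients of coordinates formed later.\<close>

definition rep :: "('a::field ^ 3) set \<Rightarrow> 'a ^ 3" where
  "rep P = (SOME p. p \<noteq> 0 \<and> vec.span {p} = P)"

lemma rep:
  assumes "P \<in> PG2_points"
  shows "rep P \<noteq> 0" "vec.span {rep P} = P"
proof -
  have P: "vec.subspace P" "vec.dim P = 1" using assms by (auto simp: PG2_points_def)
  then obtain p where p: "p \<in> P" "p \<noteq> 0" using vec.dim_eq_0[of P] by fastforce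
  have "P \<subseteq> vec.span {p}"
    using P p by (intro vec.card_ge_dim_independent) auto
  then have "vec.span {p} = P" using P p vec.span_minimal[of "{p}" P] by auto
  then have "\<exists>p. p \<noteq> 0 \<and> vec.span {p} = P" using p by blast
  then have "rep P \<noteq> 0 \<and> vec.span {rep P} = P" unfolding rep_def by (rule someI_ex)
  then show "rep P \<noteq> 0" "vec.span {rep P} = P" by auto
qed

lemma point_subset_iff:
  assumes "P \<in> PG2_points" "vec.subspace L"
  shows "P \<subseteq> L \<longleftrightarrow> rep P \<in> L"
proof
  assume "P \<subseteq> L"
  then show "rep P \<in> L" using rep(2)[OF assms(1)] vec.span_base[of "rep P" "{rep P}"] by auto
next
  assume "rep P \<in> L"
  then show "P \<subseteq> L" using rep(2)[OF assms(1)] vec.span_minimal[of "{rep P}" L] assms(2) by auto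
qed

lemma point_eqI:
  assumes P: "P \<in> PG2_points" and Q: "Q \<in> PG2_points" and k: "rep P = k *s rep Q"
  shows "P = Q"
proof -
  have "rep P \<in> Q"
    using k rep(2)[OF Q] vec.span_base[of "rep Q" "{rep Q}"] vec.span_scale[of "rep Q" "{rep Q}" k] by auto
  moreover have "vec.subspace Q" "vec.subspace P" "vec.dim P = vec.dim Q"
    using P Q by (auto simp: PG2_points_def)
  ultimately show ?thesis
    using point_subset_iff[OF P] vec.subspace_dim_equal[of P Q] by auto
qed

text \<open>Being on different ones of the lines \<open>z = 0\<close> and \<open>y = 0\<close>, the vectors \<open>q\<close> and \<open>r\<close> span \<open>L\<close>.\<close>

lemma collinear_coordinates:
  fixes T :: "'a::field ^ 3 \<Rightarrow> 'a ^ 3"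
  assumes T: "Vector_Spaces.linear (*s) (*s) T"
    and L: "vec.subspace L" "vec.dim L = 2" "p \<in> L" "q \<in> L" "r \<in> L"
    and p: "T p $ 2 \<noteq> 0" and q: "T q $ 2 \<noteq> 0" "T q $ 3 = 0" and r: "T r $ 2 = 0" "T r $ 3 \<noteq> 0"
  shows "T q $ 1 / T q $ 2 = T p $ 1 / T p $ 2 + (- T p $ 3 / T p $ 2) * (T r $ 1 / T r $ 3)"
proof -
  interpret T: Vector_Spaces.linear "(*s)" "(*s)" T by (rule T)
  have "q \<notin> vec.span {r}"
  proof
    assume "q \<in> vec.span {r}"
    then obtain k where "q = k *s r" by (auto simp: vec.span_singleton)
    then show False using q r by (simp add: T.scale)
  qed
  moreover have "r \<noteq> 0" using r by (auto simp: T.zero)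
  ultimately have ind: "vec.independent {q, r}" by (intro vec.independent_insertI) (auto simp: vec.independent_empty)
  have "q \<noteq> r" using q r by auto
  then have "L \<subseteq> vec.span {q, r}"
    using L ind by (intro vec.card_ge_dim_independent) auto
  then have "p \<in> vec.span {q, r}" using L by blast
  then obtain a b where "p - a *s q = b *s r" by (auto simp: vec.span_insert vec.span_singleton)
  then have "p = a *s q + b *s r" by (simp add: algebra_simps)
  then have Tp: "T p = a *s T q + b *s T r" by (simp add: T.add T.scale)
  then have "a \<noteq> 0" using p r by auto
  then show ?thesis using q r unfolding Tp by (simp add: field_simps)
qed

text \<open>Cramer's rule finds \<open>a\<close> and \<open>b\<close> from the second and third
  coordinates. The first coordinate follows, being the same linear function of the other two on all
  three vectors.\<close>

lemma mem_span_coordinates: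
  fixes T :: "'a::field ^ 3 \<Rightarrow> 'a ^ 3"
  assumes T: "Vector_Spaces.linear (*s) (*s) T" and inj: "inj T"
    and nz: "T p $ 2 \<noteq> 0" "T q $ 2 \<noteq> 0" "T r $ 2 \<noteq> 0"
    and ne: "T p $ 3 / T p $ 2 \<noteq> T q $ 3 / T q $ 2"
    and line: "\<And>v. v \<in> {p, q, r} \<Longrightarrow> T v $ 1 = x * T v $ 2 + y * T v $ 3"
  obtains a b where "r = a *s p + b *s q"
proof -
  interpret T: Vector_Spaces.linear "(*s)" "(*s)" T by (rule T)
  \<comment> \<open>The determinant of the second and third coordinates of \<open>T p\<close> and
    \<open>T q\<close>, nonzero because their ratios differ.\<close>
  define D where "D = T p $ 2 * T q $ 3 - T q $ 2 * T p $ 3"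
  have D: "D \<noteq> 0" using ne nz by (auto simp: D_def field_simps)
  define a where "a = (T r $ 2 * T q $ 3 - T q $ 2 * T r $ 3) / D"
  define b where "b = (T p $ 2 * T r $ 3 - T r $ 2 * T p $ 3) / D"
  have "D * T r $ 2 = (a * D) * T p $ 2 + (b * D) * T q $ 2"
    using D by (simp add: a_def b_def) (simp add: D_def algebra_simps)
  then have "D * T r $ 2 = D * (a * T p $ 2 + b * T q $ 2)" by (simp add: algebra_simps)
  then have 2: "T r $ 2 = a * T p $ 2 + b * T q $ 2" using D by simp
  have "D * T r $ 3 = (a * D) * T p $ 3 + (b * D) * T q $ 3"
    using D by (simp add: a_def b_def) (simp add: D_def algebra_simps)
  then have "D * T r $ 3 = D * (a * T p $ 3 + b * T q $ 3)" by (simp add: algebra_simps)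
  then have 3: "T r $ 3 = a * T p $ 3 + b * T q $ 3" using D by simp
  have 1: "T r $ 1 = a * T p $ 1 + b * T q $ 1"
    using line[of p] line[of q] line[of r] 2 3 by (simp add: algebra_simps)
  have "T r = T (a *s p + b *s q)"
    using 1 2 3 by (simp add: T.add T.scale vec_eq_iff forall_3)
  then show thesis using that inj injD by metis
qed


text \<open>\<open>T\<close> is applied to representatives of the points and the result
  dehomogenized. Each block is cut out by a two-dimensional subspace, so membership in a block
  becomes a linear condition.\<close>

lemma embedded_unital_coordinates:
  fixes X :: "('a::field ^ 3) set set"
  assumes U: "unital q X B" and card: "CARD('a) = q ^ 2"
    and emb: "embedded_in X B PG2_points PG2_lines"
    and b: "b1 \<in> B" "b2 \<in> B" "b1 \<inter> b2 = {}"
  obtains t s m :: "('a ^ 3) set \<Rightarrow> 'a" where "unital_coordinates q X B b1 b2 t s m"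
proof -
  interpret unital q X B by (rule U)
  have X: "P \<in> PG2_points" if "P \<in> X" for P using emb that by (auto simp: embedded_in_def)
  have line: "\<exists>L. vec.subspace L \<and> vec.dim L = 2 \<and> (\<forall>P\<in>X. P \<in> c \<longleftrightarrow> rep P \<in> L)"
    if c: "c \<in> B" for c
  proof -
    obtain l where l: "l \<in> PG2_lines" "c = X \<inter> l" using emb c by (auto simp: embedded_in_def)
    then obtain L where L: "vec.subspace L" "vec.dim L = 2" "l = {P \<in> PG2_points. P \<subseteq> L}"
      by (auto simp: PG2_lines_def)
    then have "\<forall>P\<in>X. P \<in> c \<longleftrightarrow> rep P \<in> L" using l X point_subset_iff by auto
    then show ?thesis using L by blast
  qed
  obtain L1 where L1: "vec.subspace L1" "vec.dim L1 = 2" "\<forall>P\<in>X. P \<in> b1 \<longleftrightarrow> rep P \<in> L1"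
    using line[OF b(1)] by blast
  obtain L2 where L2: "vec.subspace L2" "vec.dim L2 = 2" "\<forall>P\<in>X. P \<in> b2 \<longleftrightarrow> rep P \<in> L2"
    using line[OF b(2)] by blast
  have "b1 \<noteq> {}" using card_block[OF b(1)] by auto
  then obtain P where "P \<in> b1" by blast
  then have "P \<in> X" "P \<in> b1" "P \<notin> b2" using b block_subset[OF b(1)] by auto
  then have "L1 \<noteq> L2" using L1(3) L2(3) by auto
  then obtain T :: "'a ^ 3 \<Rightarrow> 'a ^ 3" where T: "Vector_Spaces.linear (*s) (*s) T" "inj T"
    "\<And>v. v \<in> L1 \<longleftrightarrow> T v $ 3 = 0" "\<And>v. v \<in> L2 \<longleftrightarrow> T v $ 2 = 0"
    using plane_coordinates[OF L1(1,2) L2(1,2)] by metis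
  interpret T: Vector_Spaces.linear "(*s)" "(*s)" T by (rule T(1))
  define t where "t P = T (rep P) $ 1 / T (rep P) $ 2" for P
  define s where "s P = T (rep P) $ 1 / T (rep P) $ 3" for P
  define m where "m P = - T (rep P) $ 3 / T (rep P) $ 2" for P
  have mem1: "P \<in> b1 \<longleftrightarrow> T (rep P) $ 3 = 0" and mem2: "P \<in> b2 \<longleftrightarrow> T (rep P) $ 2 = 0"
    if "P \<in> X" for P
    using that L1(3) L2(3) T(3,4) by auto
  have in1: "P \<in> X" "T (rep P) $ 3 = 0" "T (rep P) $ 2 \<noteq> 0" if "P \<in> b1" for P
    using that b block_subset[OF b(1)] mem1[of P] mem2[of P] by auto
  have in2: "P \<in> X" "T (rep P) $ 3 \<noteq> 0" "T (rep P) $ 2 = 0" if "P \<in> b2" for P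
    using that b block_subset[OF b(2)] mem1[of P] mem2[of P] by auto
  have out: "T (rep P) $ 3 \<noteq> 0" "T (rep P) $ 2 \<noteq> 0" if "P \<in> X - (b1 \<union> b2)" for P
    using that mem1[of P] mem2[of P] by auto
  have eqI: "P = Q" if PQ: "P \<in> X" "Q \<in> X" "T (rep P) = k *s T (rep Q)" for P Q k
  proof -
    have "T (rep P) = T (k *s rep Q)" using PQ by (simp add: T.scale)
    then have "rep P = k *s rep Q" by (rule injD[OF T(2)])
    then show ?thesis using point_eqI X PQ by blast
  qed
  have "unital_coordinates q X B b1 b2 t s m"
  proof (unfold_locales, goal_cases)
    \<comment> \<open>Cases 5 to 9 are \<open>inj_t\<close>, \<open>m_nonzero\<close>,
      \<open>collinear\<close>, \<open>coordinates_eqD\<close> and \<open>mem_line\<close>.\<close>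
    case 5
    show ?case
    proof (rule inj_onI)
      fix P Q assume PQ: "P \<in> b1" "Q \<in> b1" "t P = t Q"
      then have "T (rep P) = (T (rep P) $ 2 / T (rep Q) $ 2) *s T (rep Q)"
        using in1[of P] in1[of Q] by (simp add: vec_eq_iff forall_3 t_def field_simps)
      then show "P = Q" using eqI in1 PQ by blast
    qed
  next
    case (6 P)
    then show ?case using out by (simp add: m_def)
  next
    case (7 c P Q R)
    obtain L where L: "vec.subspace L" "vec.dim L = 2" "\<forall>P\<in>X. P \<in> c \<longleftrightarrow> rep P \<in> L"
      using line[OF 7(1)] by blast
    have "P \<in> X" "Q \<in> X" "R \<in> X" using 7 block_subset by blast+
    then have "rep P \<in> L" "rep Q \<in> L" "rep R \<in> L" using L(3) 7 by auto
    moreover have "T (rep P) $ 2 \<noteq> 0" using out[of P] 7 \<open>P \<in> X\<close> by auto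
    ultimately show ?case
      using collinear_coordinates[OF T(1) L(1,2)] in1[of Q] in2[of R] 7
      unfolding t_def s_def m_def by auto
  next
    case (8 P Q)
    have "T (rep P) = (T (rep P) $ 2 / T (rep Q) $ 2) *s T (rep Q)"
      using out[OF 8(1)] out[OF 8(2)] 8(3,4)
      by (simp add: vec_eq_iff forall_3 t_def m_def field_simps)
    then show ?case using eqI 8 by blast
  next
    case (9 c P Q R x y)
    obtain L where L: "vec.subspace L" "vec.dim L = 2" "\<forall>P\<in>X. P \<in> c \<longleftrightarrow> rep P \<in> L"
      using line[OF 9(1)] by blast
    have X': "P \<in> X - (b1 \<union> b2)" "Q \<in> X - (b1 \<union> b2)" "R \<in> X - (b1 \<union> b2)"
      using 9 block_subset[OF 9(1)] by auto
    \<comment> \<open>The equation \<open>x = t A + m A * y\<close> with denominators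
      cleared.\<close>
    have lin: "T (rep A) $ 1 = x * T (rep A) $ 2 + y * T (rep A) $ 3"
      if "A \<in> X - (b1 \<union> b2)" "x = t A + m A * y" for A
      using out[OF that(1)] that(2) by (simp add: t_def m_def field_simps)
    \<comment> \<open>Equal ratios give \<open>m P = m Q\<close>; the two line equations then give
      \<open>t P = t Q\<close>, so \<open>P\<close> and \<open>Q\<close> would coincide.\<close>
    have "T (rep P) $ 3 / T (rep P) $ 2 \<noteq> T (rep Q) $ 3 / T (rep Q) $ 2"
    proof
      assume "T (rep P) $ 3 / T (rep P) $ 2 = T (rep Q) $ 3 / T (rep Q) $ 2"
      then have "m P = m Q" by (simp add: m_def)
      moreover from this have "t P = t Q" using 9 by simp
      ultimately have "T (rep P) = (T (rep P) $ 2 / T (rep Q) $ 2) *s T (rep Q)"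
        using out[OF X'(1)] out[OF X'(2)]
        by (simp add: vec_eq_iff forall_3 t_def m_def field_simps)
      then show False using eqI[of P Q] X' 9 by blast
    qed
    then obtain a b where "rep R = a *s rep P + b *s rep Q"
      using mem_span_coordinates[OF T(1,2), of "rep P" "rep Q" "rep R" x y]
        out[OF X'(1)] out[OF X'(2)] out[OF X'(3)] lin X' 9 by blast
    moreover have "rep P \<in> L" "rep Q \<in> L" using L(3) 9 X' by auto
    ultimately have "rep R \<in> L" using L(1) vec.subspace_add vec.subspace_scale by metis
    then show ?case using L(3) 9 by blast
  qed (use card b in auto)
  then show thesis by (rule that)
qed

theorem theorem3p6:
  fixes q :: nat
    and X :: "('a::field ^ 3) set set"
    and B :: "('a ^ 3) set set set"
  assumes "primepow q"
    and "CARD('a) = q ^ 2"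
    and "abstract_unital q X B"
    and "embedded_in X B PG2_points PG2_lines"
  shows "strongly_full_point_regular X B"
proof -
  have "q \<ge> 2" using primepow_gt_Suc_0[OF assms(1)] by simp
  then have U: "unital q X B" using assms(3) by unfold_locales
  show ?thesis
    unfolding strongly_full_point_regular_def
  proof (intro ballI impI)
    fix b1 b2 assume b: "b1 \<in> B" "b2 \<in> B" "b1 \<inter> b2 = {}"
    obtain t s m :: "('a ^ 3) set \<Rightarrow> 'a" where "unital_coordinates q X B b1 b2 t s m"
      using embedded_unital_coordinates[OF U assms(2,4) b] .
    then interpret unital_coordinates q X B b1 b2 t s m .
    obtain c where "c \<in> B" "c \<inter> b1 = {}" "c \<inter> b2 = {}" "F \<subseteq> c"
      using full_points_subset_block .
    then show "(\<exists>c\<in>B. c \<inter> b1 = {} \<and> c \<inter> b2 = {} \<and> F \<subseteq> c) \<and>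
        permutation_group_on b1 (Persp X B b2 b1) \<and>
        cyclic_group (Persp X B b2 b1) \<and>
        semi_regular_on b1 (Persp X B b2 b1)"
      using Persp_regular by blast
  qed
qed

end
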